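(* Let $(a(n))_{n\ge 0}$ be the integer sequence defined by $a(0)=1$, $a(1)=1$, and $a(n+1)=\sum_{p=0}^{n} a(p)\,a(n-p) - 1$ for all $n\ge 1$. Then for every integer $n\ge 4$, \[ (n+1)\,a(n) + 2(-3n+1)\,a(n-1) + (9n-13)\,a(n-2) - 4\,a(n-3) + 4(-n+4)\,a(n-4) = 0. \] *)

theory Defs
  imports Main
begin

end

theory Submission
  imports Defs "HOL-Computational_Algebra.Formal_Power_Series"
begin

unbundle fps_syntax

text \<open>
  The generating function \<open>A\<close> satisfies \<open>A = 1 + x A\<^sup>2 - x\<^sup>2 / (1 - x)\<close>. Completing the square,
  \<open>Y = 1 - 2 x A\<close> satisfies \<open>Q Y\<^sup>2 = P\<close> with \<open>Q = 1 - x\<close> and \<open>P = 1 - 5x + 4x\<^sup>2 + 4x\<^sup>3\<close>.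
  Differentiating gives \<open>2 P Q Y' = (P' Q - P Q') Y\<close>, a linear differential equation for \<open>A\<close>
  whose coefficient of \<open>x\<^sup>n\<close> is the recurrence; the inhomogeneous part has degree 3, hence
  \<open>n \<ge> 4\<close>.
\<close>

lemma fps_numeral_mult_left_nth:
  "(numeral k * f) $ n = numeral k * (f $ n :: 'a :: comm_ring_1)"
  by (simp add: numeral_fps_const)

lemma fps_numeral_mult_left_eq_0D:
  fixes f :: "'a :: {idom, ring_char_0} fps"
  assumes "numeral k * f = 0"
  shows "f = 0"
  using assms by (simp add: fps_eq_iff fps_numeral_mult_left_nth)

text \<open>After substituting \<open>P = Q * Y^2\<close>, the terms with \<open>fps_deriv Q\<close>
  cancel and both sides equal \<open>2 * Q^2 * Y^2 * fps_deriv Y\<close>. No division occurs, so any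
  commutative ring will do.\<close>

lemma fps_deriv_of_quadratic_root:
  fixes P Q Y :: "'a :: comm_ring_1 fps"
  assumes "Q * Y^2 = P"
  shows "2 * (P * Q * fps_deriv Y) = (fps_deriv P * Q - P * fps_deriv Q) * Y"
  unfolding assms [symmetric] by (simp add: power2_eq_square algebra_simps)

text \<open>The factor \<open>1 - fps_X\<close> clears the geometric series that collects the
  summands -1 of the recurrence.\<close>

lemma generating_function_quadratic:
  fixes a :: "nat \<Rightarrow> int"
  assumes "a 0 = 1" and "a 1 = 1"
    and rec: "\<And>n. n \<ge> 1 \<Longrightarrow> a (n + 1) = (\<Sum>p = 0..n. a p * a (n - p)) - 1"
  shows "(1 - fps_X) * Abs_fps a
    = (1 - fps_X) + fps_X * (1 - fps_X) * (Abs_fps a)^2 - fps_X^2"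
proof -
  define A where "A = Abs_fps a"
  define E :: "int fps" where "E = Abs_fps (\<lambda>_. 1)"
  have "(1 - fps_X) * E = 1"
    by (rule fps_ext) (simp add: E_def left_diff_distrib)
  moreover have A: "A = 1 + fps_X * A^2 - fps_X^2 * E"
  proof (rule fps_ext)
    fix n :: nat
    \<comment> \<open>The recurrence yields only the coefficients from index 2 on, where
      \<open>fps_X^2 * E\<close> starts; the other two are initial values.\<close>
    consider "n = 0" | "n = 1" | m where "n = m + 1" "m \<ge> 1"
      by (metis One_nat_def add.commute less_one not_less old.nat.exhaust plus_1_eq_Suc)
    then show "A $ n = (1 + fps_X * A^2 - fps_X^2 * E) $ n"
    proof cases
      case 3
      with rec [of m] show ?thesis
        by (simp add: A_def E_def power2_eq_square [of "Abs_fps a"] fps_mult_nth [of "Abs_fps a"]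
            fps_X_power_mult_nth)
    qed (use assms in \<open>simp_all add: A_def power2_eq_square [of "Abs_fps a"] fps_X_power_mult_nth\<close>)
  qed
  moreover have "(1 - fps_X) * A = (1 - fps_X) * (1 + fps_X * A^2 - fps_X^2 * E)"
    by (rule arg_cong [OF A])
  moreover have "\<dots> = (1 - fps_X) + fps_X * (1 - fps_X) * A^2 - fps_X^2 * ((1 - fps_X) * E)"
    by algebra
  ultimately show ?thesis
    by (simp add: A_def)
qed

theorem theorem1:
  fixes a :: "nat \<Rightarrow> int"
  assumes "a 0 = 1"
    and "a 1 = 1"
    and "\<And>n. n \<ge> 1 \<Longrightarrow> a (n + 1) = (\<Sum>p = 0..n. a p * a (n - p)) - 1"
  shows "\<forall>n\<ge>4.
    (int n + 1) * a n + 2 * (- 3 * int n + 1) * a (n - 1) + (9 * int n - 13) * a (n - 2)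
      - 4 * a (n - 3) + 4 * (- int n + 4) * a (n - 4) = 0"
proof (intro allI impI)
  fix n :: nat
  assume n: "n \<ge> 4"
  define X :: "int fps" where "X = fps_X"
  define A where "A = Abs_fps a"
  \<comment> \<open>The coefficients of \<open>B\<close> are \<open>(m + 1) * a m\<close>, the
    source of the factors linear in \<open>n\<close>.\<close>
  define B where "B = fps_deriv (X * A)"
  define Y where "Y = 1 - 2 * (X * A)"
  define P where "P = 1 - 5 * X + 4 * X^2 + 4 * X^3"
  define Q where "Q = 1 - X"
  have "Q * A - X * Q * A^2 = Q - X^2"
    using generating_function_quadratic [OF assms] by (simp add: A_def Q_def X_def)
  moreover have "Q * Y^2 = Q - 4 * X * (Q * A - X * Q * A^2)"
    unfolding Y_def by algebra
  moreover have "Q - 4 * X * (Q - X^2) = P"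
    unfolding P_def Q_def by algebra
  ultimately have "Q * Y^2 = P"
    by simp
  note ode = fps_deriv_of_quadratic_root [OF this]
  have X': "fps_deriv X = 1"
    by (simp add: X_def)
  have Y': "fps_deriv Y = - 2 * B"
    by (simp add: Y_def B_def)
  have P': "fps_deriv P = - 5 + 8 * X + 12 * X^2"
    by (simp add: P_def X' fps_deriv_power power2_eq_square power3_eq_cube algebra_simps)
  have Q': "fps_deriv Q = - 1"
    by (simp add: Q_def X')
  \<comment> \<open>The coefficients at \<open>B\<close> are those of \<open>P * Q\<close>, whose
    cubic term vanishes; the terms in \<open>A\<close> are \<open>2 * X * A * ?R\<close>.\<close>
  let ?L = "B - 6 * (X * B) + 9 * (X^2 * B) - 4 * (X^4 * B)
      + 2 * (X * A) - 4 * (X^2 * A) - 4 * (X^3 * A) + 4 * (X^4 * A)"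
  let ?R = "1 - 2 * X - 2 * X^2 + 2 * X^3"
  have "4 * (?L - ?R)
      = (fps_deriv P * Q - P * fps_deriv Q) * Y - 2 * (P * Q * fps_deriv Y)"
    unfolding Y' P' Q' unfolding P_def Q_def Y_def by algebra
  also have "\<dots> = 0"
    using ode by (simp only: diff_self)
  finally have "?L - ?R = 0"
    by (rule fps_numeral_mult_left_eq_0D)
  then have "?L = ?R"
    by (simp only: right_minus_eq)
  \<comment> \<open>As \<open>n \<ge> 4\<close>, no shift by a power of \<open>X\<close> runs below
    index 0, and \<open>?R\<close> contributes nothing.\<close>
  from arg_cong [OF this, of "\<lambda>f. f $ n"]
  have "B $ n - 6 * B $ (n - 1) + 9 * B $ (n - 2) - 4 * B $ (n - 4)
      + 2 * a (n - 1) - 4 * a (n - 2) - 4 * a (n - 3) + 4 * a (n - 4) = 0"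
    using n by (simp add: X_def A_def fps_numeral_mult_left_nth fps_numeral_nth fps_X_power_mult_nth)
  moreover have "B $ m = (int m + 1) * a m" for m
    by (simp add: B_def X_def A_def algebra_simps)
  ultimately show "(int n + 1) * a n + 2 * (- 3 * int n + 1) * a (n - 1)
      + (9 * int n - 13) * a (n - 2) - 4 * a (n - 3) + 4 * (- int n + 4) * a (n - 4) = 0"
    using n by (simp add: of_nat_diff algebra_simps)
qed

end
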